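(* Let $\mathcal{S}$ be a compact convex subset of a Euclidean space with $\mathrm{Aff}(\mathcal{S}) = \mathbb{R}^2$. Then the following two conditions are equivalent: (1) The set $\mathcal{S}$ is affine isomorphic to either a triangle (i.e. a $2$-simplex) or the unit disk. (2) The group of bijective affine transformations of $\mathcal{S}$ (onto itself) acts transitively on the set $\mathcal{S}_{\mathrm{ext}}$ of extreme points of $\mathcal{S}$, and $\mathcal{S}$ has spectrality.
   Context: $\mathrm{Aff}(\mathcal{S})$ denotes the affine hull of $\mathcal{S}$. A group $G$ acts transitively on a set $X$ if for any $x_1,x_2\in X$ there is $g\in G$ with $g\cdot x_1=x_2$. Two convex sets are affine isomorphic if there is an affine bijection between them. The unit disk is the closed solid disk. Points $s_1,\dots,s_n$ of a convex subset $\mathcal{S}$ of a real vector space are distinguishable if there exist $n$ affine functionals $e_i:\mathcal{S}\to\mathbb{R}$ ($1\le i\le n$) such that $e_i\ge 0$ on $\mathcal{S}$, $\sum_{i=1}^n e_i = 1$ (constantly on $\mathcal{S}$) and $e_i(s_i)=1$ for every $1\le i\le n$. A convex set $\mathcal{S}$ has spectrality if each $s\in\mathcal{S}$ admits a decomposition $s=\sum_{j=1}^{\ell}\lambda_j s_j$ ($1\le \ell<\infty$) into distinguishable extreme points $s_1,\dots,s_\ell\in\mathcal{S}_{\mathrm{ext}}$ such that $\sum_{j=1}^{\ell}\lambda_j=1$ and $\lambda_j\ge 0$ for every $j$. *)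

theory Defs
  imports "HOL-Analysis.Analysis"
begin

definition affine_map_on :: "'a::real_vector set \<Rightarrow> ('a \<Rightarrow> 'b::real_vector) \<Rightarrow> bool" where
  "affine_map_on S f \<longleftrightarrow>
     (\<forall>x\<in>S. \<forall>y\<in>S. \<forall>t\<in>{0..1}. f ((1 - t) *\<^sub>R x + t *\<^sub>R y) = (1 - t) *\<^sub>R f x + t *\<^sub>R f y)"

definition affine_isomorphic :: "'a::real_vector set \<Rightarrow> 'b::real_vector set \<Rightarrow> bool" where
  "affine_isomorphic S T \<longleftrightarrow> (\<exists>f. affine_map_on S f \<and> bij_betw f S T)"

text \<open>The maps are required to be extensional (undefined outside \<open>S\<close>), so that the elements of
  this set are exactly the bijective affine maps of \<open>S\<close> onto itself; for convex \<open>S\<close> it is a group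
  under \<open>compose S\<close>.\<close>

definition affine_automorphisms :: "'a::real_vector set \<Rightarrow> ('a \<Rightarrow> 'a) set" where
  "affine_automorphisms S = {g \<in> extensional S. affine_map_on S g \<and> bij_betw g S S}"

definition acts_transitively_on :: "('a \<Rightarrow> 'a) set \<Rightarrow> 'a set \<Rightarrow> bool" where
  "acts_transitively_on G X \<longleftrightarrow> (\<forall>x1\<in>X. \<forall>x2\<in>X. \<exists>g\<in>G. g x1 = x2)"

definition extreme_points :: "'a::real_vector set \<Rightarrow> 'a set" where
  "extreme_points S = {x. x extreme_point_of S}"

text \<open>The points \<open>s 1, \<dots>, s n\<close> are given as a family; the values of \<open>s\<close> at other indices
  are irrelevant.\<close>

definition distinguishable :: "'a::real_vector set \<Rightarrow> nat \<Rightarrow> (nat \<Rightarrow> 'a) \<Rightarrow> bool" where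
  "distinguishable S n s \<longleftrightarrow>
     (\<forall>i\<in>{1..n}. s i \<in> S) \<and>
     (\<exists>e :: nat \<Rightarrow> 'a \<Rightarrow> real.
        (\<forall>i\<in>{1..n}. affine_map_on S (e i)) \<and>
        (\<forall>i\<in>{1..n}. \<forall>x\<in>S. 0 \<le> e i x) \<and>
        (\<forall>x\<in>S. (\<Sum>i=1..n. e i x) = 1) \<and>
        (\<forall>i\<in>{1..n}. e i (s i) = 1))"

definition spectrality :: "'a::real_vector set \<Rightarrow> bool" where
  "spectrality S \<longleftrightarrow>
     (\<forall>x\<in>S. \<exists>l \<ge> 1. \<exists>(s :: nat \<Rightarrow> 'a) (c :: nat \<Rightarrow> real).
        (\<forall>j\<in>{1..l}. s j \<in> extreme_points S) \<and>
        distinguishable S l s \<and>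
        (\<forall>j\<in>{1..l}. 0 \<le> c j) \<and>
        (\<Sum>j=1..l. c j) = 1 \<and>
        x = (\<Sum>j=1..l. c j *\<^sub>R s j))"

end

theory Submission
  imports Defs
begin

text \<open>If three points of \<open>S\<close> are distinguishable, the functionals separating them are barycentric
  coordinates that are nonnegative on \<open>S\<close>, so \<open>S\<close> is a triangle. Otherwise spectrality puts every
  point of \<open>S\<close> on a segment between two extreme points; finitely many segments have no interior, so
  there are infinitely many extreme points. Affine automorphisms of \<open>S\<close> fix its centroid \<open>c\<close> and have
  determinant \<open>\<plusminus>1\<close>, hence preserve the quadratic form \<open>w \<mapsto> \<integral>\<^sub>S det(w, x - c)\<^sup>2 dx\<close>. After a linear change
  of coordinates they are linear isometries of \<open>\<complex>\<close>, and the extreme points lie on a circle on which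
  they accumulate. Transitivity then yields arbitrarily small nontrivial rotations preserving \<open>S\<close>,
  whose powers carry an extreme point arbitrarily close to every point of the circle.\<close>

subsection \<open>Affine maps on convex sets\<close>

text \<open>Around an interior point \<open>p\<close> the increment \<open>h\<close> of
  \<open>f\<close> commutes with scaling by factors in [0,1] and with midpoints. Shrinking a vector
  until it stays in \<open>S\<close>, applying \<open>h\<close> and scaling back therefore gives a
  linear map on the whole space.\<close>

lemma affine_map_on_extend:
  fixes S :: "'a::euclidean_space set" and f :: "'a \<Rightarrow> 'b::real_vector"
  assumes "interior S \<noteq> {}" and f: "affine_map_on S f"
  obtains A b where "linear A" "\<And>x. x \<in> S \<Longrightarrow> f x = A x + b"
proof -
  obtain p \<epsilon> where \<epsilon>: "\<epsilon> > 0" "ball p \<epsilon> \<subseteq> S"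
    using assms(1) mem_interior by blast
  define h where "h v = f (p + v) - f p" for v
  have near: "p + v \<in> S" if "norm v < \<epsilon>" for v
    using that \<epsilon>(2) by (auto simp: dist_norm)
  have h_scale: "h (t *\<^sub>R v) = t *\<^sub>R h v" if "p + v \<in> S" "0 \<le> t" "t \<le> 1" for t v
  proof -
    have "f ((1 - t) *\<^sub>R p + t *\<^sub>R (p + v)) = (1 - t) *\<^sub>R f p + t *\<^sub>R f (p + v)"
      using f near[of 0] \<epsilon>(1) that unfolding affine_map_on_def by auto
    moreover have "(1 - t) *\<^sub>R p + t *\<^sub>R (p + v) = p + t *\<^sub>R v"
      by (simp add: algebra_simps)
    ultimately show ?thesis by (simp add: h_def algebra_simps)
  qed
  have h_mid: "h ((1/2) *\<^sub>R (v + w)) = (1/2) *\<^sub>R (h v + h w)" if "p + v \<in> S" "p + w \<in> S" for v w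
  proof -
    have "(1/2::real) \<in> {0..1}" by simp
    then have "f ((1 - 1/2) *\<^sub>R (p + v) + (1/2) *\<^sub>R (p + w))
        = (1 - 1/2) *\<^sub>R f (p + v) + (1/2) *\<^sub>R f (p + w)"
      using f that unfolding affine_map_on_def by blast
    moreover have "(1 - 1/2) *\<^sub>R (p + v) + (1/2) *\<^sub>R (p + w) = p + (1/2) *\<^sub>R (v + w)"
      using scaleR_half_double[of p] by (simp add: algebra_simps)
    ultimately have "f (p + (1/2) *\<^sub>R (v + w)) = (1 - 1/2) *\<^sub>R f (p + v) + (1/2) *\<^sub>R f (p + w)"
      by metis
    then show ?thesis
      using scaleR_half_double[of "f p"] by (simp add: h_def algebra_simps)
  qed
  \<comment> \<open>The factor \<open>k v\<close> shrinks \<open>v\<close>, and every vector no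
    longer than \<open>v\<close>, to length below \<epsilon>. It is positive even for the zero
    vector.\<close>
  define k where "k v = \<epsilon> / (\<epsilon> + norm v)" for v :: 'a
  have k_pos: "k v > 0" for v
    using \<epsilon>(1) by (simp add: k_def add_pos_nonneg)
  have k_near: "norm (k u *\<^sub>R v) < \<epsilon>" if "norm v \<le> norm u" for u v
  proof -
    have "\<epsilon> * norm v < \<epsilon> * (\<epsilon> + norm u)"
      using \<epsilon>(1) that by (intro mult_strict_left_mono) auto
    moreover have "\<epsilon> + norm u > 0" using \<epsilon>(1) by (simp add: add_pos_nonneg)
    ultimately show ?thesis
      using \<epsilon>(1) by (simp add: k_def divide_simps)
  qed
  define A where "A v = (1 / k v) *\<^sub>R h (k v *\<^sub>R v)" for v
  have quot: "(1 / s) *\<^sub>R h (s *\<^sub>R v) = (1 / t) *\<^sub>R h (t *\<^sub>R v)"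
    if "0 < s" "s \<le> t" "p + t *\<^sub>R v \<in> S" for s t v
    using h_scale[of "t *\<^sub>R v" "s / t"] that by simp
  \<comment> \<open>The rescaled increment is independent of the scale, as long as the scaled vector
    leads to a point of \<open>S\<close>.\<close>
  have A_eq: "A v = (1 / t) *\<^sub>R h (t *\<^sub>R v)" if "t > 0" "p + t *\<^sub>R v \<in> S" for t v
  proof (cases "t \<le> k v")
    case True
    show ?thesis
      unfolding A_def using quot[OF that(1) True near[OF k_near[OF order_refl]]] by (rule sym)
  next
    case False
    then show ?thesis
      unfolding A_def by (intro quot k_pos that(2)) simp
  qed
  have A_add: "A (v + w) = A v + A w" for v w
  proof -
    \<comment> \<open>Taking the scale of the longer vector lets a single \<open>t\<close> serve
      both. Half of it is then used for the sum, which turns additivity into the midpoint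
      rule.\<close>
    define u where "u = (if norm v \<le> norm w then w else v)"
    define t where "t = k u"
    have t: "t > 0" "p + t *\<^sub>R v \<in> S" "p + t *\<^sub>R w \<in> S"
      unfolding t_def by (intro k_pos near k_near; simp add: u_def)+
    have eq: "(t/2) *\<^sub>R (v + w) = (1/2) *\<^sub>R (t *\<^sub>R v + t *\<^sub>R w)"
      by (simp add: algebra_simps)
    have "norm ((1/2) *\<^sub>R (t *\<^sub>R v + t *\<^sub>R w)) < \<epsilon>"
      using norm_triangle_ineq[of "t *\<^sub>R v" "t *\<^sub>R w"] k_near[of v u] k_near[of w u]
      by (auto simp: t_def u_def split: if_splits)
    then have "A (v + w) = (1 / (t/2)) *\<^sub>R h ((t/2) *\<^sub>R (v + w))"
      using t(1) near eq by (intro A_eq) auto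
    also have "\<dots> = (1 / t) *\<^sub>R (h (t *\<^sub>R v) + h (t *\<^sub>R w))"
      unfolding eq using h_mid[OF t(2,3)] by simp
    finally show ?thesis
      using A_eq[OF t(1,2)] A_eq[OF t(1,3)] by (simp add: scaleR_add_right)
  qed
  have A_pos: "A (c *\<^sub>R v) = c *\<^sub>R A v" if "c > 0" for c v
  proof -
    define t where "t = k (c *\<^sub>R v)"
    have "t > 0" "p + t *\<^sub>R (c *\<^sub>R v) \<in> S"
      unfolding t_def by (intro k_pos near k_near; simp)+
    then show ?thesis
      using A_eq[of t "c *\<^sub>R v"] A_eq[of "t * c" v] that by simp
  qed
  have A_0: "A 0 = 0" using A_add[of 0 0] by simp
  have A_minus: "A (- v) = - A v" for v
    using A_add[of v "- v"] A_0 by (simp add: eq_neg_iff_add_eq_0 add.commute)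
  have "A (c *\<^sub>R v) = c *\<^sub>R A v" for c v
    using A_pos[of c v] A_pos[of "- c" v] A_minus[of "c *\<^sub>R v"] A_0
    by (cases c "0::real" rule: linorder_cases) auto
  then have lin: "linear A" using A_add by (intro linearI) auto
  \<comment> \<open>Scale 1 is admissible for \<open>x - p\<close> because it leads to
    \<open>x\<close> itself, which need not be in the ball.\<close>
  have "f x = A x + (f p - A p)" if "x \<in> S" for x
    using A_eq[of 1 "x - p"] that linear_diff[OF lin, of x p] by (simp add: h_def algebra_simps)
  then show thesis using that lin by blast
qed

lemma affine_map_on_linear_plus:
  assumes "linear A" "\<And>x. x \<in> S \<Longrightarrow> f x = A x + b" "convex S"
  shows "affine_map_on S f"
  unfolding affine_map_on_def
proof (intro ballI)
  fix x y and t :: real assume *: "x \<in> S" "y \<in> S" "t \<in> {0..1}"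
  then have "(1 - t) *\<^sub>R x + t *\<^sub>R y \<in> S"
    using assms(3) by (simp add: convex_alt)
  with * show "f ((1 - t) *\<^sub>R x + t *\<^sub>R y) = (1 - t) *\<^sub>R f x + t *\<^sub>R f y"
    using assms(2)
    by (simp add: linear_add[OF assms(1)] linear_scale[OF assms(1)] scaleR_add_right)
qed

lemma affine_map_on_compose:
  assumes "affine_map_on S f" "affine_map_on T g" "f ` S \<subseteq> T" "convex S"
  shows "affine_map_on S (g \<circ> f)"
  using assms unfolding affine_map_on_def convex_alt image_subset_iff by simp

lemma affine_map_on_restrict:
  assumes "affine_map_on S f" "convex S"
  shows "affine_map_on S (restrict f S)"
  using assms unfolding affine_map_on_def convex_alt by simp

lemma affine_map_on_inv_into:
  assumes f: "affine_map_on S f" "bij_betw f S T" and S: "convex S"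
  shows "affine_map_on T (inv_into S f)"
  unfolding affine_map_on_def
proof (intro ballI)
  let ?g = "inv_into S f"
  fix x y and t :: real assume *: "x \<in> T" "y \<in> T" "t \<in> {0..1}"
  have g: "?g x \<in> S" "?g y \<in> S" "f (?g x) = x" "f (?g y) = y"
    using * f(2) by (auto simp: bij_betw_def inv_into_into f_inv_into_f)
  have "f ((1 - t) *\<^sub>R ?g x + t *\<^sub>R ?g y) = (1 - t) *\<^sub>R x + t *\<^sub>R y"
    using f(1) g *(3) unfolding affine_map_on_def by simp
  moreover have "(1 - t) *\<^sub>R ?g x + t *\<^sub>R ?g y \<in> S"
    using S g *(3) by (simp add: convex_alt)
  ultimately show "?g ((1 - t) *\<^sub>R x + t *\<^sub>R y) = (1 - t) *\<^sub>R ?g x + t *\<^sub>R ?g y"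
    using f(2) by (metis bij_betw_inv_into_left)
qed

section \<open>Extreme points, transitivity and spectrality under affine isomorphisms\<close>

lemma extreme_point_of_affine_image:
  assumes f: "affine_map_on S f" "inj_on f S" "convex S" and x: "x \<in> S"
  shows "f x extreme_point_of f ` S \<longleftrightarrow> x extreme_point_of S"
proof -
  \<comment> \<open>An injective affine map matches open segments parameter by parameter, so the
    defining condition of extreme points carries over.\<close>
  have "f x \<in> open_segment (f a) (f b) \<longleftrightarrow> x \<in> open_segment a b" if ab: "a \<in> S" "b \<in> S" for a b
  proof -
    have seg: "(1 - u) *\<^sub>R a + u *\<^sub>R b \<in> S"
      "f ((1 - u) *\<^sub>R a + u *\<^sub>R b) = (1 - u) *\<^sub>R f a + u *\<^sub>R f b" if "0 < u" "u < 1" for u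
      using f(1,3) ab that unfolding affine_map_on_def convex_alt by auto
    have "f x = (1 - u) *\<^sub>R f a + u *\<^sub>R f b \<longleftrightarrow> x = (1 - u) *\<^sub>R a + u *\<^sub>R b" if "0 < u" "u < 1" for u
      using seg[OF that] f(2) x by (metis inj_on_contraD)
    moreover have "f a = f b \<longleftrightarrow> a = b"
      using f(2) ab by (auto dest: inj_onD)
    ultimately show ?thesis unfolding in_segment by blast
  qed
  then show ?thesis using x unfolding extreme_point_of_def by auto
qed

lemma extreme_points_affine_image:
  assumes "affine_map_on S f" "inj_on f S" "convex S"
  shows "extreme_points (f ` S) = f ` extreme_points S"
  using extreme_point_of_affine_image[OF assms]
  unfolding extreme_points_def by (auto simp: extreme_point_of_def)

lemma affine_isomorphic_trans:
  assumes "affine_isomorphic S T" "affine_isomorphic T U" "convex S"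
  shows "affine_isomorphic S U"
proof -
  obtain f g where f: "affine_map_on S f" "bij_betw f S T" and g: "affine_map_on T g" "bij_betw g T U"
    using assms(1,2) unfolding affine_isomorphic_def by blast
  have "affine_map_on S (g \<circ> f)"
    using f g assms(3) by (intro affine_map_on_compose[where T = T]) (auto simp: bij_betw_def)
  then show ?thesis
    using bij_betw_trans[OF f(2) g(2)] unfolding affine_isomorphic_def by blast
qed

lemma convex_affine_image:
  assumes "affine_map_on S f" "convex S"
  shows "convex (f ` S)"
  unfolding convex_alt
proof (safe)
  fix x y and u :: real assume "x \<in> S" "y \<in> S" "0 \<le> u" "u \<le> 1"
  then have "(1 - u) *\<^sub>R f x + u *\<^sub>R f y = f ((1 - u) *\<^sub>R x + u *\<^sub>R y)"
     "(1 - u) *\<^sub>R x + u *\<^sub>R y \<in> S"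
    using assms unfolding affine_map_on_def convex_alt by auto
  then show "(1 - u) *\<^sub>R f x + u *\<^sub>R f y \<in> f ` S" by simp
qed

text \<open>An automorphism of \<open>T\<close> is conjugated by the isomorphism \<open>f\<close>;
  the final \<open>restrict\<close> provides the extensionality that
  \<open>affine_automorphisms\<close> demands.\<close>

lemma transitive_affine_isomorphic:
  assumes iso: "affine_isomorphic S T" and S: "convex S"
    and trans: "acts_transitively_on (affine_automorphisms T) (extreme_points T)"
  shows "acts_transitively_on (affine_automorphisms S) (extreme_points S)"
  unfolding acts_transitively_on_def
proof (intro ballI)
  fix x y assume xy: "x \<in> extreme_points S" "y \<in> extreme_points S"
  obtain f where f: "affine_map_on S f" "bij_betw f S T"
    using iso affine_isomorphic_def by blast
  let ?f' = "inv_into S f"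
  have fS: "f ` S = T" "inj_on f S" using f(2) by (auto simp: bij_betw_def)
  have xyS: "x \<in> S" "y \<in> S" using xy by (auto simp: extreme_points_def extreme_point_of_def)
  have "f x \<in> extreme_points T" "f y \<in> extreme_points T"
    using xy extreme_points_affine_image[OF f(1) fS(2) S] fS(1) by auto
  then obtain g where g: "affine_map_on T g" "bij_betw g T T" "g (f x) = f y"
    using trans unfolding acts_transitively_on_def affine_automorphisms_def by blast
  let ?h = "restrict (?f' \<circ> (g \<circ> f)) S"
  have gT: "g ` T = T" using g(2) by (simp add: bij_betw_def)
  have gf: "affine_map_on S (g \<circ> f)" "(g \<circ> f) ` S \<subseteq> T"
    using affine_map_on_compose[OF f(1) g(1)] fS(1) gT S by auto
  have "affine_map_on S ?h"
    using affine_map_on_compose[OF gf(1) affine_map_on_inv_into[OF f S] gf(2)] S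
    by (intro affine_map_on_restrict) auto
  moreover have "bij_betw ?h S S"
    using bij_betw_trans[OF bij_betw_trans[OF f(2) g(2)] bij_betw_inv_into[OF f(2)]]
    by (simp cong: bij_betw_cong)
  moreover have "?h x = y"
    using g(3) xyS fS(2) by simp
  ultimately show "\<exists>g\<in>affine_automorphisms S. g x = y"
    unfolding affine_automorphisms_def by blast
qed

text \<open>A decomposition of \<open>f x\<close> is pulled back to \<open>S\<close>, and its
  functionals are composed with \<open>f\<close>. The interior of \<open>T\<close> is used to write
  the inverse of \<open>f\<close> as a linear map plus a constant, which respects convex
  combinations of any length.\<close>

lemma spectrality_affine_isomorphic:
  fixes S :: "'a::euclidean_space set" and T :: "'b::euclidean_space set"
  assumes iso: "affine_isomorphic S T" and S: "convex S" and T: "interior T \<noteq> {}"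
    and spec: "spectrality T"
  shows "spectrality S"
  unfolding spectrality_def
proof (intro ballI)
  fix x assume x: "x \<in> S"
  obtain f where f: "affine_map_on S f" "bij_betw f S T"
    using iso affine_isomorphic_def by blast
  let ?f' = "inv_into S f"
  have fS: "f ` S = T" "inj_on f S" using f(2) by (auto simp: bij_betw_def)
  have f': "affine_map_on T ?f'" "inj_on ?f' T" "?f' ` T = S"
    using affine_map_on_inv_into[OF f S] bij_betw_inv_into[OF f(2)] by (auto simp: bij_betw_def)
  have convT: "convex T" using convex_affine_image[OF f(1) S] fS(1) by simp
  obtain A b where A: "linear A" "\<And>y. y \<in> T \<Longrightarrow> ?f' y = A y + b"
    using affine_map_on_extend[OF T f'(1)] by blast
  have "f x \<in> T" using x fS(1) by blast
  from bspec[OF spec[unfolded spectrality_def] this]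
  obtain l s c where l: "l \<ge> 1" "\<forall>j\<in>{1..l}. s j \<in> extreme_points T" "distinguishable T l s"
     "\<forall>j\<in>{1..l}. 0 \<le> c j" "(\<Sum>j=1..l. c j) = 1" "f x = (\<Sum>j=1..l. c j *\<^sub>R s j)"
    by (elim exE conjE)
  have sT: "s j \<in> T" if "j \<in> {1..l}" for j
    using l(3) that unfolding distinguishable_def by blast
  obtain e where e: "\<forall>i\<in>{1..l}. affine_map_on T (e i)" "\<forall>i\<in>{1..l}. \<forall>x\<in>T. 0 \<le> (e i x :: real)"
    "\<forall>x\<in>T. (\<Sum>i=1..l. e i x) = 1" "\<forall>i\<in>{1..l}. e i (s i) = 1"
    using l(3) unfolding distinguishable_def by blast
  have "distinguishable S l (?f' \<circ> s)"
    unfolding distinguishable_def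
  proof (intro conjI exI[of _ "\<lambda>i. e i \<circ> f"])
    show "\<forall>i\<in>{1..l}. affine_map_on S (e i \<circ> f)"
      using affine_map_on_compose f(1) e(1) fS(1) S by blast
  qed (use e fS f'(3) sT in \<open>auto simp: f_inv_into_f inv_into_into\<close>)
  moreover have "\<forall>j\<in>{1..l}. (?f' \<circ> s) j \<in> extreme_points S"
    using extreme_points_affine_image[OF f'(1,2) convT] f'(3) l(2) by auto
  moreover have "x = (\<Sum>j=1..l. c j *\<^sub>R (?f' \<circ> s) j)"
  proof -
    have "x = A (f x) + b" using A(2)[of "f x"] x fS by auto
    also have "\<dots> = (\<Sum>j=1..l. c j *\<^sub>R A (s j)) + (\<Sum>j=1..l. c j) *\<^sub>R b"
      unfolding l(5,6) by (simp add: linear_sum[OF A(1)] linear_scale[OF A(1)])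
    also have "\<dots> = (\<Sum>j=1..l. c j *\<^sub>R (A (s j) + b))"
      by (simp add: scaleR_add_right sum.distrib scaleR_sum_left)
    finally show ?thesis using A(2) sT by simp
  qed
  ultimately show "\<exists>l\<ge>1. \<exists>s c. (\<forall>j\<in>{1..l}. s j \<in> extreme_points S) \<and> distinguishable S l s \<and>
      (\<forall>j\<in>{1..l}. 0 \<le> c j) \<and> (\<Sum>j=1..l. c j) = 1 \<and> x = (\<Sum>j=1..l. c j *\<^sub>R s j)"
    using l(1,4,5) by blast
qed

subsection \<open>Simplices and balls\<close>

text \<open>The function \<open>1 + f (x - c)\<close> is the barycentric coordinate of the vertex
  \<open>c\<close>. After moving \<open>c\<close> to the origin the other vertices are linearly
  independent, so \<open>f\<close> may be prescribed as -1 on them.\<close>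

lemma affine_independent_coordinate:
  fixes C :: "'a::euclidean_space set"
  assumes "\<not> affine_dependent C" and c: "c \<in> C"
  obtains f :: "'a \<Rightarrow> real" where "linear f" "\<forall>c'\<in>C. 1 + f (c' - c) = of_bool (c' = c)"
proof -
  let ?B = "(\<lambda>x. - c + x) ` (C - {c})"
  have "independent ?B"
    using assms affine_dependent_iff_dependent2 by blast
  then obtain f :: "'a \<Rightarrow> real" where f: "linear f" "\<forall>x\<in>?B. f x = - 1"
    using linear_independent_extend[of ?B "\<lambda>_. - 1"] by auto
  have "1 + f (c' - c) = of_bool (c' = c)" if "c' \<in> C" for c'
    using f(2) that linear_0[OF f(1)] by (cases "c' = c") auto
  then show thesis using that f(1) by blast
qed

text \<open>The transposition of the vertices \<open>c\<close> and \<open>d\<close> extends to an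
  affine map: \<open>x\<close> moves along \<open>c - d\<close> by the difference of its coordinates
  at \<open>c\<close> and \<open>d\<close>.\<close>

lemma transitive_simplex:
  fixes C :: "'a::euclidean_space set"
  assumes C: "\<not> affine_dependent C"
  shows "acts_transitively_on (affine_automorphisms (convex hull C)) (extreme_points (convex hull C))"
  unfolding acts_transitively_on_def
proof (intro ballI)
  let ?T = "convex hull C"
  fix c d assume "c \<in> extreme_points ?T" "d \<in> extreme_points ?T"
  then have cd: "c \<in> C" "d \<in> C"
    using extreme_point_of_convex_hull_affine_independent[OF C] by (auto simp: extreme_points_def)
  obtain f where f: "linear f" "\<forall>c'\<in>C. 1 + f (c' - c) = (of_bool (c' = c) :: real)"
    using affine_independent_coordinate[OF C cd(1)] .
  obtain h where h: "linear h" "\<forall>c'\<in>C. 1 + h (c' - d) = (of_bool (c' = d) :: real)"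
    using affine_independent_coordinate[OF C cd(2)] .
  define A where "A x = x - (f x - h x) *\<^sub>R (c - d)" for x
  define b where "b = (f c - h d) *\<^sub>R (c - d)"
  have A: "linear A"
  proof (rule linearI)
    show "A (x + y) = A x + A y" for x y
      by (simp add: A_def linear_add[OF f(1)] linear_add[OF h(1)] scaleR_left_diff_distrib scaleR_left_distrib)
    show "A (t *\<^sub>R x) = t *\<^sub>R A x" for t x
      by (simp add: A_def linear_scale[OF f(1)] linear_scale[OF h(1)] scaleR_diff_right flip: right_diff_distrib)
  qed
  define g where "g x = A x + b" for x
  have g: "g x = x - ((1 + f (x - c)) - (1 + h (x - d))) *\<^sub>R (c - d)" for x
    by (simp add: g_def A_def b_def linear_diff[OF f(1)] linear_diff[OF h(1)] algebra_simps)
  have gC: "g x = (if x = c then d else if x = d then c else x)" if "x \<in> C" for x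
    unfolding g using f(2) h(2) that by simp
  have "g ` ?T = convex hull (g ` C)"
  proof -
    have "g ` X = (\<lambda>x. b + x) ` A ` X" for X
      by (auto simp: g_def image_image add.commute)
    then show ?thesis
      by (simp add: convex_hull_linear_image[OF A] convex_hull_translation)
  qed
  moreover have "g ` C = C"
  proof
    show "g ` C \<subseteq> C" using gC cd by auto
    show "C \<subseteq> g ` C"
    proof
      fix x assume "x \<in> C"
      then have "g x \<in> C" using gC cd by simp
      then have "g (g x) = x" using gC \<open>x \<in> C\<close> cd by simp
      with \<open>g x \<in> C\<close> show "x \<in> g ` C" by (metis imageI)
    qed
  qed
  ultimately have gT: "g ` ?T = ?T" by simp
  \<comment> \<open>The coordinate difference is 1 at \<open>c\<close> and -1 at \<open>d\<close>,
    so \<open>g\<close> reverses its sign and the second move undoes the first. This makes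
    \<open>g\<close> bijective.\<close>
  have "g (g x) = x" for x
  proof (cases "c = d")
    case False
    have "f c = f d + 1" "h d = h c + 1"
      using bspec[OF f(2) cd(2)] bspec[OF h(2) cd(1)] False
      by (auto simp: linear_diff[OF f(1)] linear_diff[OF h(1)])
    then have "f (x - m *\<^sub>R (c - d)) - h (x - m *\<^sub>R (c - d)) = f x - h x - 2 * m" for m
      by (simp add: linear_diff[OF f(1)] linear_diff[OF h(1)] linear_scale[OF f(1)]
          linear_scale[OF h(1)])
    from this[of "(1 + f (x - c)) - (1 + h (x - d))"]
    have "f (g x) - h (g x) = f x - h x - 2 * ((1 + f (x - c)) - (1 + h (x - d)))"
      by (simp only: g)
    then have "(1 + f (g x - c)) - (1 + h (g x - d)) = - ((1 + f (x - c)) - (1 + h (x - d)))"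
      by (simp add: linear_diff[OF f(1)] linear_diff[OF h(1)])
    then have "g (g x) = g x + ((1 + f (x - c)) - (1 + h (x - d))) *\<^sub>R (c - d)"
      by (subst g) (simp only: scaleR_minus_left diff_minus_eq_add)
    also have "\<dots> = x" by (subst g) (rule diff_add_cancel)
    finally show ?thesis .
  qed (simp add: g)
  then have "inj_on g ?T" by (metis inj_on_inverseI)
  then have "bij_betw g ?T ?T" using gT by (simp add: bij_betw_def)
  then have "bij_betw (restrict g ?T) ?T ?T" by (simp only: bij_betw_restrict_eq)
  moreover have "affine_map_on ?T (restrict g ?T)"
    using affine_map_on_linear_plus[OF A g_def] by (intro affine_map_on_restrict) auto
  moreover have "restrict g ?T c = d"
    using gC[OF cd(1)] cd hull_inc[of c C] by simp
  ultimately show "\<exists>g\<in>affine_automorphisms ?T. g c = d"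
    unfolding affine_automorphisms_def by blast
qed

text \<open>The barycentric coordinates play two roles: as functions they distinguish the vertices,
  and their values at \<open>x\<close> are the weights of the decomposition.\<close>

lemma spectrality_simplex:
  fixes C :: "'a::euclidean_space set"
  assumes C: "\<not> affine_dependent C"
  shows "spectrality (convex hull C)"
  unfolding spectrality_def
proof (intro ballI)
  let ?T = "convex hull C"
  let ?l = "card C"
  fix x assume x: "x \<in> ?T"
  have fin: "finite C" using C aff_independent_finite by blast
  obtain s where s: "bij_betw s {1..?l} C"
    using ex_bij_betw_nat_finite_1[OF fin] by blast
  have sum_s: "(\<Sum>i=1..?l. f (s i)) = sum f C" for f :: "'a \<Rightarrow> 'b::comm_monoid_add"
    using sum.reindex_bij_betw[OF s] .
  have "\<forall>c\<in>C. \<exists>f :: 'a \<Rightarrow> real. linear f \<and> (\<forall>c'\<in>C. 1 + f (c' - c) = of_bool (c' = c))"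
    using affine_independent_coordinate[OF C] by metis
  then obtain f where f: "\<And>c. c \<in> C \<Longrightarrow> linear (f c)"
      "\<And>c c'. c \<in> C \<Longrightarrow> c' \<in> C \<Longrightarrow> 1 + f c (c' - c) = (of_bool (c' = c) :: real)"
    by metis
  define e where "e c y = 1 + f c (y - c)" for c y
  have e_affine: "e c y = f c y + (1 - f c c)" if "c \<in> C" for c y
    using linear_diff[OF f(1)[OF that]] by (simp add: e_def)
  \<comment> \<open>An affine function of an affine combination is the combination of its values,
    and \<open>e c\<close> is 1 at \<open>c\<close> and 0 at the other vertices.\<close>
  have coord: "e c y = u c" if u: "sum u C = 1" "(\<Sum>v\<in>C. u v *\<^sub>R v) = y" and c: "c \<in> C" for u y c
  proof -
    have "f c y = (\<Sum>v\<in>C. u v * f c v)"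
      unfolding u(2)[symmetric] linear_sum[OF f(1)[OF c]] linear_scale[OF f(1)[OF c]] by simp
    then have "e c y = (\<Sum>v\<in>C. u v * f c v) + (\<Sum>v\<in>C. u v) * (1 - f c c)"
      using e_affine[OF c] u(1) by simp
    also have "\<dots> = (\<Sum>v\<in>C. u v * e c v)"
      by (simp add: e_affine[OF c] sum_distrib_right sum.distrib[symmetric] algebra_simps)
    also have "\<dots> = (\<Sum>v\<in>C. if v = c then u v else 0)"
      using f(2)[OF c] by (intro sum.cong) (auto simp: e_def)
    also have "\<dots> = u c"
      using fin c by simp
    finally show ?thesis .
  qed
  have hull: "\<exists>u. (\<forall>v\<in>C. 0 \<le> u v) \<and> sum u C = 1 \<and> (\<Sum>v\<in>C. u v *\<^sub>R v) = y" if "y \<in> ?T" for y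
    using that convex_hull_finite[OF fin] by auto
  have e_props: "(\<forall>c\<in>C. 0 \<le> e c y) \<and> (\<Sum>c\<in>C. e c y) = 1 \<and> (\<Sum>c\<in>C. e c y *\<^sub>R c) = y"
    if y: "y \<in> ?T" for y
  proof -
    obtain u where "\<forall>v\<in>C. 0 \<le> u v" "sum u C = 1" "(\<Sum>v\<in>C. u v *\<^sub>R v) = y"
      using hull[OF y] by blast
    with coord[of u y] show ?thesis by auto
  qed
  have sC: "s i \<in> C" if "i \<in> {1..?l}" for i
    using s that bij_betwE by blast
  have "distinguishable ?T ?l s"
    unfolding distinguishable_def
  proof (intro conjI exI[of _ "\<lambda>i. e (s i)"])
    show "\<forall>i\<in>{1..?l}. affine_map_on ?T (e (s i))"
      using affine_map_on_linear_plus[OF f(1) e_affine] sC by auto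
    show "\<forall>x\<in>?T. (\<Sum>i=1..?l. e (s i) x) = 1"
      using e_props sum_s[of "\<lambda>c. e c _"] by simp
    show "\<forall>i\<in>{1..?l}. e (s i) (s i) = 1"
      using linear_0[OF f(1)[OF sC]] by (simp add: e_def)
  qed (use sC e_props hull_inc[of _ C] in auto)
  moreover have "\<forall>j\<in>{1..?l}. s j \<in> extreme_points ?T"
    using sC extreme_point_of_convex_hull_affine_independent[OF C] by (simp add: extreme_points_def)
  moreover have "?l \<ge> 1" using x fin by (cases "C = {}") (auto simp: Suc_le_eq card_gt_0_iff)
  moreover have "\<forall>j\<in>{1..?l}. 0 \<le> e (s j) x" using e_props[OF x] sC by blast
  moreover have "(\<Sum>j=1..?l. e (s j) x) = 1"
    using e_props[OF x] sum_s[of "\<lambda>c. e c x"] by simp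
  moreover have "x = (\<Sum>j=1..?l. e (s j) x *\<^sub>R s j)"
    using e_props[OF x] sum_s[of "\<lambda>c. e c x *\<^sub>R c"] by simp
  ultimately show "\<exists>l\<ge>1. \<exists>s c. (\<forall>j\<in>{1..l}. s j \<in> extreme_points ?T) \<and> distinguishable ?T l s \<and>
      (\<forall>j\<in>{1..l}. 0 \<le> c j) \<and> (\<Sum>j=1..l. c j) = 1 \<and> x = (\<Sum>j=1..l. c j *\<^sub>R s j)"
    by (intro exI[of _ ?l] conjI exI[of _ s] exI[of _ "\<lambda>j. e (s j) x"])
qed

section \<open>Balls: extreme points, transitivity and spectrality\<close>

lemma extreme_points_cball:
  fixes a :: "'a::euclidean_space"
  shows "extreme_points (cball a r) = sphere a r"
proof
  show "extreme_points (cball a r) \<subseteq> sphere a r"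
  proof
    fix x assume "x \<in> extreme_points (cball a r)"
    then have "x extreme_point_of cball a r" by (simp add: extreme_points_def)
    moreover have "x \<notin> interior (cball a r)"
      using calculation extreme_point_not_in_interior by blast
    ultimately show "x \<in> sphere a r"
      by (auto simp: extreme_point_of_def interior_cball)
  qed
  show "sphere a r \<subseteq> extreme_points (cball a r)"
  proof
    fix x assume x: "x \<in> sphere a r"
    \<comment> \<open>A point inside a segment is strictly closer to the centre than one of the
      endpoints, which is impossible at distance \<open>r\<close>.\<close>
    have "x \<notin> open_segment y z" if "y \<in> cball a r" "z \<in> cball a r" for y z
      using dist_decreases_open_segment[of x y z a] x that by auto
    then show "x \<in> extreme_points (cball a r)"
      using x by (auto simp: extreme_points_def extreme_point_of_def)
  qed
qed

lemma transitive_cball: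
  "acts_transitively_on (affine_automorphisms (cball (0 :: real^'n) r)) (extreme_points (cball 0 r))"
  unfolding acts_transitively_on_def extreme_points_cball
proof (intro ballI)
  let ?D = "cball (0 :: real^'n) r"
  fix x y :: "real^'n" assume xy: "x \<in> sphere 0 r" "y \<in> sphere 0 r"
  then obtain f where f: "orthogonal_transformation f" "f x = y"
    using orthogonal_transformation_exists[of x y] by auto
  have "f ` ?D = ?D"
    using image_orthogonal_transformation_cball[OF f(1), of 0 r] linear_0[OF orthogonal_transformation_linear[OF f(1)]]
    by simp
  then have "bij_betw f ?D ?D"
    using orthogonal_transformation_inj[OF f(1)] by (auto simp: bij_betw_def intro: inj_on_subset)
  then have "bij_betw (restrict f ?D) ?D ?D" by (simp only: bij_betw_restrict_eq)
  moreover have "affine_map_on ?D (restrict f ?D)"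
    using affine_map_on_linear_plus[OF orthogonal_transformation_linear[OF f(1)], of ?D f 0]
    by (intro affine_map_on_restrict) auto
  moreover have "restrict f ?D x = y" using f(2) xy by auto
  ultimately show "\<exists>g\<in>affine_automorphisms ?D. g x = y"
    unfolding affine_automorphisms_def by blast
qed

text \<open>Every point lies on a diameter, and the antipodal endpoints \<open>u\<close> and
  \<open>- u\<close> are told apart by the functionals (1 + u.y)/2 and (1 - u.y)/2.\<close>

lemma spectrality_cball: "spectrality (cball (0 :: 'a::euclidean_space) 1)"
  unfolding spectrality_def extreme_points_cball
proof (intro ballI)
  let ?D = "cball (0 :: 'a) 1"
  fix x assume x: "x \<in> ?D"
  obtain u :: 'a where u: "norm u = 1" "x = norm x *\<^sub>R u"
  proof (cases "x = 0")
    case True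
    obtain u :: 'a where "norm u = 1" using vector_choose_size[of 1] by auto
    with True show thesis by (intro that[of u]) auto
  next
    case False
    then show thesis by (intro that[of "x /\<^sub>R norm x"]) auto
  qed
  \<comment> \<open>The sign \<sigma> selects the endpoint: index 1 stands for \<open>u\<close> and
    index 2 for \<open>- u\<close>. The weights \<open>c\<close> are the values of the functionals
    at \<open>x\<close>.\<close>
  define \<sigma> :: "nat \<Rightarrow> real" where "\<sigma> j = (if j = 1 then 1 else - 1)" for j
  define s where "s j = \<sigma> j *\<^sub>R u" for j
  define c where "c j = (1 + \<sigma> j * norm x) / 2" for j
  define e where "e j y = (1 + \<sigma> j * (u \<bullet> y)) / 2" for j y
  have two: "{1..2::nat} = {1, 2}" by auto
  have "\<bar>u \<bullet> y\<bar> \<le> 1" if "norm y \<le> 1" for y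
    using Cauchy_Schwarz_ineq2[of u y] u(1) that by simp
  then have e_pos: "0 \<le> e j y" if "norm y \<le> 1" for j y
    using that unfolding e_def \<sigma>_def by (auto simp: abs_le_iff) (smt (verit))
  have e_affine: "affine_map_on ?D (e j)" for j
    by (rule affine_map_on_linear_plus[where A = "\<lambda>y. \<sigma> j / 2 * (u \<bullet> y)" and b = "1/2"])
       (auto simp: e_def inner_add_right algebra_simps add_divide_distrib intro!: linearI)
  have "distinguishable ?D 2 s"
    unfolding distinguishable_def two
    by (intro conjI exI[of _ e])
       (use e_pos e_affine u(1) in \<open>auto simp: e_def s_def \<sigma>_def dot_square_norm field_simps\<close>)
  moreover have "\<forall>j\<in>{1..2}. s j \<in> sphere 0 1" using u(1) by (auto simp: s_def \<sigma>_def)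
  moreover have "\<forall>j\<in>{1..2}. 0 \<le> c j" using x by (auto simp: c_def \<sigma>_def)
  moreover have "(\<Sum>j=1..2. c j) = 1" unfolding two by (simp add: c_def \<sigma>_def field_simps)
  moreover have "x = (\<Sum>j=1..2. c j *\<^sub>R s j)"
  proof -
    have "(\<Sum>j=1..2. c j *\<^sub>R s j) = (c 1 - c 2) *\<^sub>R u"
      unfolding two by (simp add: s_def \<sigma>_def algebra_simps)
    also have "c 1 - c 2 = norm x" by (simp add: c_def \<sigma>_def field_simps)
    finally show ?thesis using u(2) by simp
  qed
  ultimately show "\<exists>l\<ge>1. \<exists>s c. (\<forall>j\<in>{1..l}. s j \<in> sphere 0 1) \<and> distinguishable ?D l s \<and>
      (\<forall>j\<in>{1..l}. 0 \<le> c j) \<and> (\<Sum>j=1..l. c j) = 1 \<and> x = (\<Sum>j=1..l. c j *\<^sub>R s j)"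
    by (intro exI[of _ 2] conjI exI[of _ s] exI[of _ c]) simp_all
qed

subsection \<open>Distinguishable points\<close>

text \<open>At \<open>s j\<close> the functional with index \<open>j\<close> already takes the value
  1; the others are nonnegative and the total is 1, so they vanish there.\<close>

lemma distinguishable_functionals:
  fixes S :: "'a::euclidean_space set"
  assumes "interior S \<noteq> {}" and dist: "distinguishable S n s"
  obtains A b where "\<And>i. i \<in> {1..n} \<Longrightarrow> linear (A i :: 'a \<Rightarrow> real)"
    and "\<And>i x. i \<in> {1..n} \<Longrightarrow> x \<in> S \<Longrightarrow> 0 \<le> A i x + b i"
    and "\<And>i j. i \<in> {1..n} \<Longrightarrow> j \<in> {1..n} \<Longrightarrow> A i (s j) + b i = of_bool (i = j)"
proof -
  obtain e where e: "\<forall>i\<in>{1..n}. affine_map_on S (e i)" "\<forall>i\<in>{1..n}. \<forall>x\<in>S. 0 \<le> (e i x :: real)"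
    "\<forall>x\<in>S. (\<Sum>i=1..n. e i x) = 1" "\<forall>i\<in>{1..n}. e i (s i) = 1" and s: "\<forall>i\<in>{1..n}. s i \<in> S"
    using dist unfolding distinguishable_def by blast
  have "\<forall>i\<in>{1..n}. \<exists>A b. linear A \<and> (\<forall>x\<in>S. e i x = A x + b)"
    using affine_map_on_extend[OF assms(1)] e(1) by metis
  then obtain A b where Ab: "\<And>i. i \<in> {1..n} \<Longrightarrow> linear (A i :: 'a \<Rightarrow> real)"
      "\<And>i x. i \<in> {1..n} \<Longrightarrow> x \<in> S \<Longrightarrow> e i x = A i x + b i"
    by metis
  have "e i (s j) = of_bool (i = j)" if i: "i \<in> {1..n}" and j: "j \<in> {1..n}" for i j
  proof (cases "i = j")
    case False
    have "(\<Sum>i\<in>{1..n} - {j}. e i (s j)) = 0"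
      using e(3,4) s j by (simp add: sum_diff1)
    moreover have "\<forall>i\<in>{1..n} - {j}. 0 \<le> e i (s j)"
      using e(2) s j by blast
    ultimately have "\<forall>i\<in>{1..n} - {j}. e i (s j) = 0"
      by (subst (asm) sum_nonneg_eq_0_iff) auto
    then show ?thesis using False i by simp
  qed (use e(4) i in simp)
  then show thesis
    using that[of A b] Ab e(2) s by simp
qed

text \<open>Applying the functional with index \<open>i\<close> to an affine dependence leaves only
  the coefficient of \<open>s i\<close>, which must then be zero.\<close>

lemma distinguishable_affine_independent:
  fixes S :: "'a::euclidean_space set"
  assumes "interior S \<noteq> {}" "distinguishable S n s"
  shows "inj_on s {1..n}" "\<not> affine_dependent (s ` {1..n})"
proof -
  obtain A b where A: "\<And>i. i \<in> {1..n} \<Longrightarrow> linear (A i :: 'a \<Rightarrow> real)"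
    and e: "\<And>i j. i \<in> {1..n} \<Longrightarrow> j \<in> {1..n} \<Longrightarrow> A i (s j) + b i = of_bool (i = j)"
    using distinguishable_functionals[OF assms] by metis
  show inj: "inj_on s {1..n}"
  proof (rule inj_onI)
    fix i j assume ij: "i \<in> {1..n}" "j \<in> {1..n}" "s i = s j"
    then show "i = j" using e[OF ij(1,1)] e[OF ij(1,2)] by (cases "i = j") auto
  qed
  have "u (s i) = 0" if u: "sum u (s ` {1..n}) = 0" "(\<Sum>v\<in>s ` {1..n}. u v *\<^sub>R v) = 0"
    and i: "i \<in> {1..n}" for u i
  proof -
    have u': "(\<Sum>j=1..n. u (s j)) = 0" "(\<Sum>j=1..n. u (s j) *\<^sub>R s j) = 0"
      using u by (simp_all only: sum.reindex[OF inj] o_def)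
    have "0 = A i (\<Sum>j=1..n. u (s j) *\<^sub>R s j) + (\<Sum>j=1..n. u (s j)) * b i"
      unfolding u' using linear_0[OF A[OF i]] by simp
    also have "\<dots> = (\<Sum>j=1..n. u (s j) * (A i (s j) + b i))"
      by (simp add: linear_sum[OF A[OF i]] linear_scale[OF A[OF i]] sum_distrib_right
          distrib_left sum.distrib)
    also have "\<dots> = (\<Sum>j=1..n. if j = i then u (s j) else 0)"
      using e[OF i] by (intro sum.cong) auto
    also have "\<dots> = u (s i)" using i by simp
    finally show ?thesis by simp
  qed
  then show "\<not> affine_dependent (s ` {1..n})"
    by (subst affine_dependent_explicit_finite) auto
qed

text \<open>One point more than the dimension, affinely independent, spans the space affinely. The
  coordinates of a point of \<open>S\<close> are the values of the functionals there, hence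
  nonnegative.\<close>

lemma distinguishable_imp_simplex:
  fixes S :: "'a::euclidean_space set"
  assumes "interior S \<noteq> {}" "convex S" "distinguishable S (Suc DIM('a)) s"
  shows "int DIM('a) simplex S"
proof -
  let ?I = "{1..Suc DIM('a)}"
  obtain A b where A: "\<And>i. i \<in> ?I \<Longrightarrow> linear (A i :: 'a \<Rightarrow> real)"
    and pos: "\<And>i x. i \<in> ?I \<Longrightarrow> x \<in> S \<Longrightarrow> 0 \<le> A i x + b i"
    and e: "\<And>i j. i \<in> ?I \<Longrightarrow> j \<in> ?I \<Longrightarrow> A i (s j) + b i = of_bool (i = j)"
    using distinguishable_functionals[OF assms(1,3)] by metis
  note inj = distinguishable_affine_independent(1)[OF assms(1,3)]
  note indep = distinguishable_affine_independent(2)[OF assms(1,3)]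
  have card: "card (s ` ?I) = Suc DIM('a)"
    using card_image[OF inj] by simp
  have "S \<subseteq> convex hull (s ` ?I)"
  proof
    fix x assume x: "x \<in> S"
    have "x \<in> affine hull (s ` ?I)"
      using affine_independent_span_eq[OF indep card] by simp
    then obtain u where u: "sum u (s ` ?I) = 1" "(\<Sum>v\<in>s ` ?I. u v *\<^sub>R v) = x"
      using affine_hull_finite[of "s ` ?I"] by auto
    have u': "(\<Sum>j\<in>?I. u (s j)) = 1" "(\<Sum>j\<in>?I. u (s j) *\<^sub>R s j) = x"
      using u by (simp_all only: sum.reindex[OF inj] o_def)
    have "0 \<le> u (s i)" if i: "i \<in> ?I" for i
    proof -
      have "A i x + b i = A i (\<Sum>j\<in>?I. u (s j) *\<^sub>R s j) + (\<Sum>j\<in>?I. u (s j)) * b i"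
        unfolding u' by simp
      also have "\<dots> = (\<Sum>j\<in>?I. u (s j) * (A i (s j) + b i))"
        by (simp only: linear_sum[OF A[OF i]] linear_scale[OF A[OF i]] sum_distrib_right
          distrib_left sum.distrib real_scaleR_def)
      also have "\<dots> = (\<Sum>j\<in>?I. if j = i then u (s j) else 0)"
        using e[OF i] by (intro sum.cong) auto
      also have "\<dots> = u (s i)" using i by (subst sum.delta) auto
      finally show ?thesis using pos[OF i x] by simp
    qed
    then show "x \<in> convex hull (s ` ?I)"
      unfolding convex_hull_finite[OF finite_imageI[OF finite_atLeastAtMost]]
      by (intro CollectI exI[of _ u] conjI u) auto
  qed
  moreover have "convex hull (s ` ?I) \<subseteq> S"
    using assms(2,3) unfolding distinguishable_def by (intro hull_minimal) auto
  ultimately show ?thesis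
    using indep card unfolding simplex_def by (intro exI[of _ "s ` ?I"]) auto
qed

lemma spectrality_infinite_extreme_points:
  fixes S :: "'a::euclidean_space set"
  assumes dim: "DIM('a) = 2" and S: "interior S \<noteq> {}" "convex S" and spec: "spectrality S"
    and nsimplex: "\<not> 2 simplex S"
  shows "infinite (extreme_points S)"
proof
  let ?E = "extreme_points S"
  assume fin: "finite ?E"
  have "S \<subseteq> (\<Union>(a, b)\<in>?E \<times> ?E. closed_segment a b)"
  proof
    fix x assume "x \<in> S"
    from bspec[OF spec[unfolded spectrality_def] this]
    obtain l s c where l: "l \<ge> 1" "\<forall>j\<in>{1..l}. s j \<in> ?E" "distinguishable S l s"
      "\<forall>j\<in>{1..l}. 0 \<le> c j" "(\<Sum>j=1..l. c j) = 1" "x = (\<Sum>j=1..l. c j *\<^sub>R s j)"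
      by (elim exE conjE)
    note indep = distinguishable_affine_independent[OF S(1) l(3)]
    \<comment> \<open>Affine independence in a plane allows at most three points, and three
      distinguishable ones would make \<open>S\<close> a triangle.\<close>
    have "int l - 1 = aff_dim (s ` {1..l})"
      using aff_dim_affine_independent[OF indep(2)] card_image[OF indep(1)] by simp
    also have "\<dots> \<le> 2" using aff_dim_le_DIM[of "s ` {1..l}"] dim by simp
    finally have "l \<le> 3" by simp
    moreover have "l \<noteq> 3"
      using distinguishable_imp_simplex[OF S, of s] l(3) nsimplex dim by (auto simp: numeral_3_eq_3)
    ultimately consider "l = 1" | "l = 2" using l(1) by linarith
    then show "x \<in> (\<Union>(a, b)\<in>?E \<times> ?E. closed_segment a b)"
    proof cases
      case 1
      then have "x \<in> ?E" using l by simp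
      then show ?thesis by force
    next
      case 2
      have two: "{1..2::nat} = {1, 2}" by auto
      have c: "0 \<le> c 1" "0 \<le> c 2" "c 1 + c 2 = 1"
        using l(4,5) unfolding 2 two by auto
      then have c1: "c 1 = 1 - c 2" by simp
      have "x = (1 - c 2) *\<^sub>R s 1 + c 2 *\<^sub>R s 2" "0 \<le> c 2" "c 2 \<le> 1"
        using l(6) c unfolding 2 two c1[symmetric] by auto
      then have "x \<in> closed_segment (s 1) (s 2)" by (auto simp: in_segment)
      moreover have "s 1 \<in> ?E" "s 2 \<in> ?E" using l(2) unfolding 2 two by auto
      ultimately show ?thesis by blast
    qed
  qed
  \<comment> \<open>In dimension two a segment has empty interior and, being convex, is negligible;
    a finite union of segments cannot cover the interior of \<open>S\<close>.\<close>
  moreover have "negligible (closed_segment a b)" for a b :: 'a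
    using negligible_convex_interior[of "closed_segment a b"] interior_closed_segment_ge2[of a b] dim
    by simp
  then have "negligible (\<Union>(a, b)\<in>?E \<times> ?E. closed_segment a b)"
    using fin by (intro negligible_Union) auto
  ultimately have "negligible (interior S)"
    using negligible_subset interior_subset by (metis subset_trans)
  then show False using S(1) open_not_negligible by blast
qed

subsection \<open>Transitive isometry groups of convex sets in the complex plane\<close>

text \<open>After dividing by \<open>B 1\<close>, the image \<open>w\<close> of \<i> has norm 1 and
  \<open>1 + w\<close> has the norm of \<open>1 + \<i>\<close>. This forces \<open>w\<close> to be
  \<i> (a rotation) or its negative (a reflection).\<close>

lemma norm_preserving_complex:
  fixes B :: "complex \<Rightarrow> complex"
  assumes B: "linear B" "\<And>z. norm (B z) = norm z"
  obtains u where "norm u = 1" "(\<forall>z. B z = u * z) \<or> (\<forall>z. B z = u * cnj z)"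
proof -
  define u where "u = B 1"
  have u: "norm u = 1" using B(2)[of 1] by (simp add: u_def)
  then have u0: "u \<noteq> 0" by auto
  define w where "w = B \<i> / u"
  have Bi: "B \<i> = u * w" using u0 by (simp add: w_def)
  have w1: "norm w = 1" using B(2)[of \<i>] u by (simp add: w_def norm_divide)
  have "B (1 + \<i>) = u * (1 + w)"
    by (simp add: linear_add[OF B(1)] Bi distrib_left u_def)
  then have "norm (1 + w) = norm (1 + \<i>)"
    using B(2)[of "1 + \<i>"] u by (simp add: norm_mult)
  then have "(1 + Re w)\<^sup>2 + (Im w)\<^sup>2 = 2" "(Re w)\<^sup>2 + (Im w)\<^sup>2 = 1"
    using w1 by (simp_all add: cmod_def)
  then have "Re w = 0" by (simp add: power2_eq_square algebra_simps)
  with \<open>(Re w)\<^sup>2 + (Im w)\<^sup>2 = 1\<close> have "(Im w)\<^sup>2 = 1" by simp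
  with \<open>Re w = 0\<close>  have "w = \<i> \<or> w = - \<i>" by (auto simp: complex_eq_iff power2_eq_1_iff)
  moreover have "B z = u * (of_real (Re z) + of_real (Im z) * w)" for z
  proof -
    have "z = Re z *\<^sub>R 1 + Im z *\<^sub>R \<i>" by (simp add: complex_eq_iff)
    then have "B z = Re z *\<^sub>R B 1 + Im z *\<^sub>R B \<i>"
      by (metis linear_add[OF B(1)] linear_scale[OF B(1)])
    then show ?thesis by (simp add: Bi u_def scaleR_conv_of_real algebra_simps)
  qed
  ultimately have "(\<forall>z. B z = u * z) \<or> (\<forall>z. B z = u * cnj z)"
    by (auto simp: complex_eq_iff)
  then show thesis using that u by blast
qed

text \<open>The powers of \<open>v\<close> walk around the circle in equal steps; some power falls
  within one step of \<open>w\<close>, and chords grow with the angle up to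
  \<open>pi\<close>.\<close>

lemma cis_powers_near:
  fixes v w :: complex
  assumes v: "norm v = 1" "v \<noteq> 1" and w: "norm w = 1"
  obtains n :: nat where "norm (v ^ n - w) \<le> norm (v - 1)"
proof -
  have cis_dist: "(norm (cis t - 1))\<^sup>2 = 2 - 2 * cos \<bar>t\<bar>" for t
  proof -
    have "(norm (cis t - 1))\<^sup>2 = (cos t - 1)\<^sup>2 + (sin t)\<^sup>2" by (simp add: cmod_power2)
    then show ?thesis using sin_cos_squared_add[of t] by (simp add: power2_eq_square algebra_simps)
  qed
  define \<theta> where "\<theta> = Arg v"
  have v_cis: "v = cis \<theta>"
    using v(1) by (metis \<theta>_def cis_Arg norm_zero sgn_div_norm scaleR_one inverse_1 zero_neq_one)
  have \<theta>: "\<theta> \<noteq> 0" "\<bar>\<theta>\<bar> \<le> pi"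
  proof -
    show "\<theta> \<noteq> 0" using v(2) v_cis by (metis cis_zero)
    show "\<bar>\<theta>\<bar> \<le> pi" using Arg_bounded[of v] unfolding \<theta>_def by linarith
  qed
  \<comment> \<open>A full turn is added in the direction of \<theta>, so that \<phi> is a
    nonnegative multiple of \<theta> and rounding down yields a natural exponent.\<close>
  define \<phi> where "\<phi> = Arg w + (if \<theta> > 0 then 2 * pi else - 2 * pi)"
  have "w = cis (Arg w)"
    using w by (metis cis_Arg norm_zero sgn_div_norm scaleR_one inverse_1 zero_neq_one)
  moreover have "cis \<phi> = cis (Arg w)"
    by (simp add: \<phi>_def complex_eq_iff sin_add cos_add sin_diff cos_diff)
  ultimately have w_cis: "w = cis \<phi>" by simp
  have q: "\<phi> / \<theta> \<ge> 0"
    using Arg_bounded[of w] \<theta>(1) by (auto simp: \<phi>_def divide_simps)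
  define n where "n = nat \<lfloor>\<phi> / \<theta>\<rfloor>"
  have "\<bar>real n - \<phi> / \<theta>\<bar> \<le> 1"
    using q unfolding n_def by linarith
  then have "\<bar>real n - \<phi> / \<theta>\<bar> * \<bar>\<theta>\<bar> \<le> 1 * \<bar>\<theta>\<bar>"
    by (rule mult_right_mono) simp
  then have "\<bar>real n * \<theta> - \<phi>\<bar> \<le> \<bar>\<theta>\<bar>"
    using \<theta>(1) by (simp add: abs_mult[symmetric] left_diff_distrib)
  then have "cos \<bar>\<theta>\<bar> \<le> cos \<bar>real n * \<theta> - \<phi>\<bar>"
    using \<theta>(2) by (intro cos_monotone_0_pi_le) auto
  then have "(norm (cis (real n * \<theta> - \<phi>) - 1))\<^sup>2 \<le> (norm (v - 1))\<^sup>2"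
    unfolding v_cis cis_dist by simp
  then have "norm (cis (real n * \<theta> - \<phi>) - 1) \<le> norm (v - 1)"
    by (rule power2_le_imp_le) simp
  moreover have "v ^ n - w = w * (cis (real n * \<theta> - \<phi>) - 1)"
    by (simp add: v_cis w_cis Complex.DeMoivre cis_mult algebra_simps)
  ultimately show thesis using that[of n] w by (simp add: norm_mult)
qed

text \<open>By Bolzano-Weierstrass there is a limit point, and its ball of radius \<open>e/2\<close>
  contains infinitely many points of \<open>E\<close>.\<close>

lemma infinite_bounded_close_points:
  fixes E :: "'a::euclidean_space set"
  assumes "infinite E" "bounded E" "e > 0"
  obtains x y where "x \<in> E" "y \<in> E" "x \<noteq> y" "dist x y < e"
proof -
  obtain l where "l islimpt E"
    using assms(1,2) bounded_infinite_imp_islimpt[OF order_refl] by blast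
  then have "infinite (E \<inter> ball l (e/2))"
    using assms(3) by (auto simp: islimpt_eq_infinite_ball)
  then obtain x where x: "x \<in> E \<inter> ball l (e/2)"
    by (metis finite.emptyI ex_in_conv)
  with \<open>infinite (E \<inter> ball l (e/2))\<close> obtain y where "y \<in> E \<inter> ball l (e/2)" "y \<noteq> x"
    by (metis finite.intros ex_in_conv finite_insert insert_Diff_single infinite_remove DiffE singletonI)
  then show thesis
    using that[of x y] x dist_triangle_half_r[of l x e y] by auto
qed

lemma complex_transitive_imp_cball:
  fixes K :: "complex set"
  assumes K: "compact K" "convex K" and inf: "infinite (extreme_points K)"
    and trans: "\<And>x y. x \<in> extreme_points K \<Longrightarrow> y \<in> extreme_points K \<Longrightarrow>
      \<exists>B. linear B \<and> (\<forall>z. norm (B z) = norm z) \<and> B ` K = K \<and> B x = y"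
  obtains r where "r > 0" "K = cball 0 r"
proof -
  let ?E = "extreme_points K"
  obtain x0 where x0: "x0 \<in> ?E" using inf by (metis finite.emptyI ex_in_conv)
  define r where "r = norm x0"
  have norm_E: "norm y = r" if "y \<in> ?E" for y
    using trans[OF x0 that] r_def by auto
  have "r \<noteq> 0"
  proof
    assume "r = 0"
    then have "?E \<subseteq> {0}" using norm_E by auto
    then show False using inf finite_subset by blast
  qed
  then have r: "r > 0" by (simp add: r_def)
  have E_sub: "?E \<subseteq> K" by (auto simp: extreme_points_def extreme_point_of_def)
  \<comment> \<open>\<open>M\<close> collects the rotations mapping \<open>K\<close> into itself;
    inclusion is enough for iterating them.\<close>
  define M where "M = {v. norm v = 1 \<and> (\<forall>z\<in>K. v * z \<in> K)}"
  \<comment> \<open>With \<open>f\<close> equal to \<open>id\<close> or \<open>cnj\<close>,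
    \<open>P f y\<close> says that a symmetry of that orientation takes \<open>x0\<close> to
    \<open>y\<close>. One orientation must reach infinitely many extreme points.\<close>
  define P where "P f y \<longleftrightarrow> (\<exists>u. norm u = 1 \<and> (\<lambda>z. u * f z) ` K = K \<and> u * f x0 = y)"
    for f :: "complex \<Rightarrow> complex" and y
  have "P id y \<or> P cnj y" if y: "y \<in> ?E" for y
  proof -
    obtain B where B: "linear B" "\<forall>z. norm (B z) = norm z" "B ` K = K" "B x0 = y"
      using trans[OF x0 y] by blast
    then obtain u where u: "norm u = 1" "(\<forall>z. B z = u * z) \<or> (\<forall>z. B z = u * cnj z)"
      using norm_preserving_complex[of B] by metis
    then have "B = (\<lambda>z. u * id z) \<or> B = (\<lambda>z. u * cnj z)" by auto
    then show ?thesis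
      using u(1) B(3,4) unfolding P_def by auto
  qed
  then have "?E = {y\<in>?E. P id y} \<union> {y\<in>?E. P cnj y}" by blast
  \<comment> \<open>Quotients of two isometries of the same orientation are rotations.\<close>
  then obtain f where f: "infinite {y\<in>?E. P f y}"
    using inf by (metis finite_UnI)
  have quot: "y' / y \<in> M" if yy: "P f y" "P f y'" for y y'
  proof -
    obtain u u' where u: "norm u = 1" "(\<lambda>z. u * f z) ` K = K" "u * f x0 = y"
      and u': "norm u' = 1" "(\<lambda>z. u' * f z) ` K = K" "u' * f x0 = y'"
      using yy unfolding P_def by blast
    have u0: "u \<noteq> 0" using u(1) by auto
    have "f x0 \<noteq> 0"
    proof
      assume "f x0 = 0"
      then have "{y\<in>?E. P f y} \<subseteq> {0}" by (auto simp: P_def)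
      then show False using f finite_subset by blast
    qed
    then have eq: "y' / y = u' / u" using u(3) u'(3) by auto
    have "u' / u * z \<in> K" if "z \<in> K" for z
    proof -
      have "z \<in> (\<lambda>z. u * f z) ` K" using u(2) that by simp
      then obtain k where k: "k \<in> K" "z = u * f k" by (elim imageE)
      then have "u' / u * z = u' * f k" using u0 by simp
      moreover have "u' * f k \<in> (\<lambda>z. u' * f z) ` K" using k(1) by (rule imageI)
      ultimately show ?thesis using u'(2) by simp
    qed
    then show ?thesis using u(1) u'(1) unfolding M_def eq by (simp add: norm_divide)
  qed
  have pow: "v ^ n * z \<in> K" if "v \<in> M" "z \<in> K" for v z n
    using that by (induction n) (auto simp: M_def mult.assoc)
  \<comment> \<open>Two distinct extreme points that are close together and reached with the same
    orientation have a quotient close to 1, since both have norm \<open>r\<close>.\<close>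
  have small: "\<exists>v\<in>M. v \<noteq> 1 \<and> norm (v - 1) < e" if e: "e > 0" for e
  proof -
    have bdd: "bounded {y\<in>?E. P f y}"
      using norm_E by (auto simp: bounded_iff)
    have er: "e * r > 0" using e r by simp
    obtain y y' where "y \<in> {y\<in>?E. P f y}" "y' \<in> {y\<in>?E. P f y}" "y \<noteq> y'" "dist y y' < e * r"
      by (rule infinite_bounded_close_points[OF f bdd er])
    then have y: "y \<in> ?E" "P f y" "y' \<in> ?E" "P f y'" "y \<noteq> y'" "dist y y' < e * r" by auto
    have y0: "y \<noteq> 0" "norm y = r" using norm_E[OF y(1)] r by auto
    have "y' / y - 1 = (y' - y) / y" using y0 by (simp add: diff_divide_distrib)
    then have "norm (y' / y - 1) = dist y y' / r"
      using y0 by (simp add: dist_norm norm_minus_commute norm_divide)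
    then have "norm (y' / y - 1) < e" using y(6) r by (simp only: pos_divide_less_eq)
    then show ?thesis using quot[OF y(2,4)] y(5) y0 by (intro bexI[of _ "y' / y"]) auto
  qed
  have "sphere 0 r \<subseteq> K"
  proof
    fix w :: complex assume w: "w \<in> sphere 0 r"
    have x00: "x0 \<noteq> 0" using r by (auto simp: r_def)
    have "\<exists>y\<in>K. dist y w < e" if e: "e > 0" for e
    proof -
      \<comment> \<open>The powers of \<open>v\<close> approximate the rotation
        \<open>w / x0\<close>, so they carry \<open>x0\<close> close to \<open>w\<close>; the factor
        \<open>r\<close> comes from the norm of \<open>x0\<close>.\<close>
      obtain v where v: "v \<in> M" "v \<noteq> 1" "norm (v - 1) < e / r"
        using small[of "e / r"] e r by auto
      have "norm v = 1" "norm (w / x0) = 1"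
        using v(1) w x00 by (auto simp: M_def norm_divide r_def)
      then obtain n where "norm (v ^ n - w / x0) \<le> norm (v - 1)"
        using cis_powers_near v(2) by metis
      then have "norm (v ^ n - w / x0) < e / r" using v(3) by simp
      then have "norm (v ^ n - w / x0) * r < e" using r by (simp only: pos_less_divide_eq)
      moreover have "v ^ n * x0 - w = (v ^ n - w / x0) * x0"
        using x00 by (simp add: left_diff_distrib)
      ultimately have "dist (v ^ n * x0) w < e"
        by (simp add: dist_norm norm_mult r_def)
      then show ?thesis using pow[OF v(1)] x0 E_sub by blast
    qed
    then have "w \<in> closure K" by (auto simp: closure_approachable)
    then show "w \<in> K" using compact_imp_closed[OF K(1)] by simp
  qed
  \<comment> \<open>Krein-Milman is used twice: the ball is the hull of its sphere, and below
    \<open>K\<close> is the hull of extreme points of norm \<open>r\<close>.\<close>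
  moreover have "cball 0 r = convex hull (sphere (0::complex) r)"
    using Krein_Milman_Minkowski[of "cball (0::complex) r"] extreme_points_cball[of "0::complex" r]
    by (simp add: extreme_points_def)
  ultimately have "cball 0 r \<subseteq> K" using K(2) by (simp add: hull_minimal)
  moreover have "K \<subseteq> cball 0 r"
  proof -
    have "K = convex hull ?E"
      using Krein_Milman_Minkowski[OF K] by (simp add: extreme_points_def)
    moreover have "?E \<subseteq> cball 0 r" using norm_E by auto
    ultimately show ?thesis by (metis hull_minimal convex_cball)
  qed
  ultimately show thesis using that r by blast
qed

subsection \<open>An invariant Euclidean norm\<close>

lemma absolutely_integrable_on_compact:
  fixes f :: "'a::euclidean_space \<Rightarrow> 'b::euclidean_space"
  assumes "compact S" "continuous_on UNIV f"
  shows "f absolutely_integrable_on S"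
proof -
  obtain a b where ab: "S \<subseteq> cbox a b"
    using compact_imp_bounded[OF assms(1)] bounded_subset_cbox_symmetric by blast
  have "f absolutely_integrable_on cbox a b"
    using assms(2) continuous_on_subset by (intro absolutely_integrable_continuous) blast
  moreover have "S \<in> sets lebesgue"
    using lmeasurable_compact[OF assms(1)] by (rule fmeasurableD)
  ultimately show ?thesis using ab by (rule set_integrable_subset)
qed

lemma integrable_on_compact:
  fixes f :: "'a::euclidean_space \<Rightarrow> 'b::euclidean_space"
  assumes "compact S" "continuous_on UNIV f"
  shows "f integrable_on S"
  using absolutely_integrable_on_compact[OF assms] by (simp add: absolutely_integrable_on_def)

text \<open>Translation keeps the volume and \<open>A\<close> multiplies it by the absolute
  determinant; the volume of \<open>S\<close> is finite and nonzero.\<close>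

lemma abs_det_affine_automorphism:
  fixes A :: "real^'n::{finite,wellorder} \<Rightarrow> real^'n::_"
  assumes "S \<in> lmeasurable" "measure lebesgue S \<noteq> 0" "linear A" "(\<lambda>x. A x + b) ` S = S"
  shows "\<bar>det (matrix A)\<bar> = 1"
proof -
  have "(\<lambda>x. A x + b) ` S = (+) b ` A ` S" by (auto simp: image_image add.commute)
  then have "measure lebesgue S = measure lebesgue (A ` S)"
    using assms(4) measure_translation[of b "A ` S"] by simp
  then show ?thesis
    using measure_linear_image[OF assms(3,1)] assms(2) by simp
qed

lemma integral_affine_automorphism:
  fixes A :: "real^'n::{finite,wellorder} \<Rightarrow> real^'n::_" and f :: "real^'n::_ \<Rightarrow> real^'m"
  assumes S: "S \<in> lmeasurable" "measure lebesgue S \<noteq> 0" and A: "linear A" "(\<lambda>x. A x + b) ` S = S"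
    and f: "f absolutely_integrable_on S"
  shows "integral S (\<lambda>x. f (A x + b)) = integral S f"
proof -
  note det = abs_det_affine_automorphism[OF S A]
  then have "inj A" using det_nz_iff_inj[OF A(1)] by force
  then have inj: "inj_on (\<lambda>x. A x + b) S"
    by (auto simp: inj_on_def inj_def)
  have "((\<lambda>x. A x + b) has_derivative A) (at x within S)" for x
    using linear_imp_has_derivative[OF A(1)] by (auto intro!: derivative_eq_intros)
  from has_absolute_integral_change_of_variables[OF fmeasurableD[OF S(1)] this inj, of f "integral S f"]
  show ?thesis using det f A(2) by simp
qed

text \<open>The real integrand is read as a vector in \<open>real^1\<close>, so that the
  vector-valued rule applies, and its single component is extracted afterwards.\<close>

lemma integral_affine_automorphism_real:
  fixes A :: "real^'n::{finite,wellorder} \<Rightarrow> real^'n::_" and f :: "real^'n::_ \<Rightarrow> real"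
  assumes S: "compact S" "measure lebesgue S \<noteq> 0" and A: "linear A" "(\<lambda>x. A x + b) ` S = S"
    and f: "continuous_on UNIV f"
  shows "integral S (\<lambda>x. f (A x + b)) = integral S f"
proof -
  let ?F = "\<lambda>x. (\<chi> i. f x) :: real^1"
  have contF: "continuous_on UNIV ?F"
    using f by (intro continuous_on_vec_lambda)
  have contA: "continuous_on UNIV (\<lambda>x. A x + b)"
    using linear_continuous_on[OF linear_conv_bounded_linear[THEN iffD1, OF A(1)]]
    by (intro continuous_intros)
  have contFA: "continuous_on UNIV (\<lambda>x. ?F (A x + b))"
    using continuous_on_compose2[OF contF contA] by auto
  have "integral S (\<lambda>x. ?F (A x + b)) = integral S ?F"
    using integral_affine_automorphism[OF lmeasurable_compact[OF S(1)] S(2) A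
        absolutely_integrable_on_compact[OF S(1) contF]] .
  then have "integral S (\<lambda>x. ?F (A x + b) $ 1) = integral S (\<lambda>x. ?F x $ 1)"
    using integral_component_eq_cart[OF integrable_on_compact[OF S(1) contF], of 1]
      integral_component_eq_cart[OF integrable_on_compact[OF S(1) contFA], of 1] by simp
  then show ?thesis by simp
qed

text \<open>Change of variables is applied to the identity function, and \<open>A\<close> is pulled
  out of the integral by linearity.\<close>

lemma centroid_affine_automorphism:
  fixes A :: "real^'n::{finite,wellorder} \<Rightarrow> real^'n::_"
  defines "centroid S \<equiv> (1 / measure lebesgue S) *\<^sub>R integral S (\<lambda>x. x)"
  assumes S: "compact S" "measure lebesgue S \<noteq> 0" and A: "linear A" "(\<lambda>x. A x + b) ` S = S"
  shows "A (centroid S) + b = centroid S"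
proof -
  let ?m = "measure lebesgue S"
  have blA: "bounded_linear A" using A(1) linear_conv_bounded_linear by blast
  have int_id: "(\<lambda>x. x) integrable_on S" by (intro integrable_on_compact S continuous_intros)
  have int_A: "A integrable_on S"
    by (intro integrable_on_compact S linear_continuous_on blA)
  have int_1: "(\<lambda>x. 1 :: real) integrable_on S" by (intro integrable_on_compact S continuous_intros)
  have int_b: "(\<lambda>x. b) integrable_on S" by (intro integrable_on_compact S continuous_intros)
  have "integral S (\<lambda>x. x) = integral S (\<lambda>x. A x + b)"
    using integral_affine_automorphism[OF lmeasurable_compact[OF S(1)] S(2) A
        absolutely_integrable_on_compact[OF S(1)], of "\<lambda>x. x"] by simp
  also have "\<dots> = integral S A + integral S (\<lambda>x. b)"
    by (rule integral_add[OF int_A int_b])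
  also have "integral S A = A (integral S (\<lambda>x. x))"
    using integral_linear[OF int_id blA] by (simp add: o_def)
  also have "integral S (\<lambda>x. b) = ?m *\<^sub>R b"
    using integral_linear[OF int_1 bounded_linear_scaleR_left, of b]
      lmeasure_integral[OF lmeasurable_compact[OF S(1)]] by (simp add: o_def)
  finally have "centroid S = (1 / ?m) *\<^sub>R (A (integral S (\<lambda>x. x)) + ?m *\<^sub>R b)"
    unfolding centroid_def by simp
  also have "\<dots> = A (centroid S) + b"
    using S(2) by (simp add: centroid_def linear_scale[OF A(1)] scaleR_add_right)
  finally show ?thesis by simp
qed

text \<open>This is the determinant of the matrix with columns \<open>v\<close> and
  \<open>w\<close>, the signed area of their parallelogram.\<close>

definition wedge :: "real^2 \<Rightarrow> real^2 \<Rightarrow> real" where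
  "wedge v w = v $ 1 * w $ 2 - v $ 2 * w $ 1"

lemma wedge_linear_image:
  assumes "linear A"
  shows "wedge (A v) (A w) = det (matrix A) * wedge v w"
proof -
  have "A x = matrix A *v x" for x using assms by (simp add: matrix_works linear_matrix_vector_mul_eq)
  then have *: "A x $ i = matrix A $ i $ 1 * x $ 1 + matrix A $ i $ 2 * x $ 2" for x i
    by (simp add: matrix_vector_mult_def sum_2)
  show ?thesis unfolding wedge_def * det_2 by (simp add: algebra_simps)
qed

lemma continuous_on_wedge [continuous_intros]:
  "continuous_on T f \<Longrightarrow> continuous_on T (\<lambda>x. wedge w (f x))"
  unfolding wedge_def by (intro continuous_intros)

text \<open>Both arguments of \<open>wedge w (x - c)\<close> transform by \<open>A\<close>, so the
  square only gains the factor \<open>(det (matrix A))\<^sup>2\<close>, which is 1. The integral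
  \<open>q\<close> is hence invariant and, \<open>S\<close> having interior points, positive
  definite; \<open>L\<close> takes it to the Euclidean norm.\<close>

lemma affine_invariant_norm:
  fixes S :: "(real^2) set"
  assumes S: "compact S" "interior S \<noteq> {}"
  obtains c and L :: "real^2 \<Rightarrow> complex" where "linear L" "inj L"
    and "\<And>A b. linear A \<Longrightarrow> (\<lambda>x. A x + b) ` S = S \<Longrightarrow> A c + b = c"
    and "\<And>A b w. linear A \<Longrightarrow> (\<lambda>x. A x + b) ` S = S \<Longrightarrow> norm (L (A w)) = norm (L w)"
proof -
  have m: "measure lebesgue S \<noteq> 0"
  proof
    assume "measure lebesgue S = 0"
    then have "negligible S"
      using negligible_iff_measure lmeasurable_compact[OF S(1)] by blast
    then have "negligible (interior S)" using interior_subset negligible_subset by blast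
    then show False using S(2) open_not_negligible by blast
  qed
  define c where "c = (1 / measure lebesgue S) *\<^sub>R integral S (\<lambda>x. x)"
  have fixc: "A c + b = c" if "linear A" "(\<lambda>x. A x + b) ` S = S" for A b
    unfolding c_def using centroid_affine_automorphism[OF S(1) m that] .
  define q where "q w = integral S (\<lambda>x. (wedge w (x - c))\<^sup>2)" for w
  have int: "(\<lambda>x. (wedge w (x - c))\<^sup>2) integrable_on T" if "compact T" for w T
    by (intro integrable_on_compact that continuous_intros)
  have q_inv: "q (A w) = q w" if A: "linear A" "(\<lambda>x. A x + b) ` S = S" for A b w
  proof -
    have "q (A w) = integral S (\<lambda>x. (wedge (A w) (A x + b - c))\<^sup>2)"
      unfolding q_def
      by (rule integral_affine_automorphism_real[OF S(1) m A, symmetric]) (intro continuous_intros)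
    also have "\<dots> = integral S (\<lambda>x. (wedge w (x - c))\<^sup>2)"
    proof (rule integral_cong)
      fix x
      have "A x + b - c = A (x - c)"
        using fixc[OF A] by (simp add: linear_diff[OF A(1)] algebra_simps)
      moreover have "(det (matrix A))\<^sup>2 = 1"
        using abs_det_affine_automorphism[OF lmeasurable_compact[OF S(1)] m A]
        by (metis power2_abs one_power2)
      ultimately show "(wedge (A w) (A x + b - c))\<^sup>2 = (wedge w (x - c))\<^sup>2"
        by (simp add: wedge_linear_image[OF A(1)] power_mult_distrib)
    qed
    finally show ?thesis unfolding q_def .
  qed
  have q_pos: "q w > 0" if w: "w \<noteq> 0" for w
  proof (rule ccontr)
    assume "\<not> q w > 0"
    let ?f = "\<lambda>x. (wedge w (x - c))\<^sup>2"
    obtain p where "p \<in> interior S" using S(2) by blast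
    then obtain a b where ab: "p \<in> box a b" "cbox a b \<subseteq> interior S"
      using open_contains_cbox[of "interior S"] open_interior by (metis)
    \<comment> \<open>The integrand is nonnegative, so \<open>q w\<close> dominates its integral
      over a box in \<open>S\<close>. If that is zero, the continuous integrand vanishes on the
      box.\<close>
    have "integral (cbox a b) ?f \<le> q w"
      unfolding q_def using ab(2) interior_subset
      by (intro integral_subset_le int S compact_cbox) auto
    moreover have "integral (cbox a b) ?f \<ge> 0"
      by (intro integral_nonneg int compact_cbox) auto
    ultimately have "integral (cbox a b) ?f = 0" using \<open>\<not> q w > 0\<close> by simp
    then have "(?f has_integral 0) (cbox a b)"
      using int[OF compact_cbox] by (metis integrable_integral)
    then have zero: "?f x = 0" if "x \<in> cbox a b" for x
      using ab(1) that
      by (intro has_integral_0_cbox_imp_0[of a b ?f]) (auto intro!: continuous_intros)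
    obtain \<epsilon> where \<epsilon>: "\<epsilon> > 0" "ball p \<epsilon> \<subseteq> box a b"
      using ab(1) open_box openE by blast
    \<comment> \<open>Comparing \<open>p\<close> with a nearby point in each axis direction shows
      that \<open>wedge w\<close> kills both axis vectors; those values are the coordinates of
      \<open>w\<close> up to sign and scale.\<close>
    have "wedge w ((\<epsilon>/2) *\<^sub>R axis i 1) = 0" for i
    proof -
      have "p + (\<epsilon>/2) *\<^sub>R axis i 1 \<in> ball p \<epsilon>" "p \<in> ball p \<epsilon>"
        using \<epsilon>(1) by (auto simp: dist_norm)
      then have "?f (p + (\<epsilon>/2) *\<^sub>R axis i 1) = 0" "?f p = 0"
        using zero \<epsilon>(2) box_subset_cbox by blast+
      moreover have "wedge w (p + (\<epsilon>/2) *\<^sub>R axis i 1 - c) = wedge w (p - c) + wedge w ((\<epsilon>/2) *\<^sub>R axis i 1)"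
        by (simp add: wedge_def algebra_simps)
      ultimately show ?thesis by simp
    qed
    from this[of 1] this[of 2] have "w = 0"
      using \<epsilon>(1) by (simp add: wedge_def axis_def vec_eq_iff forall_2)
    then show False using w by simp
  qed
  define \<alpha> where "\<alpha> = integral S (\<lambda>x. ((x - c) $ 2)\<^sup>2)"
  define \<beta> where "\<beta> = integral S (\<lambda>x. (x - c) $ 1 * (x - c) $ 2)"
  define \<delta> where "\<delta> = integral S (\<lambda>x. ((x - c) $ 1)\<^sup>2)"
  have q_eq: "q w = (w $ 1)\<^sup>2 * \<alpha> - 2 * w $ 1 * w $ 2 * \<beta> + (w $ 2)\<^sup>2 * \<delta>" for w
  proof -
    have "(\<lambda>x. (wedge w (x - c))\<^sup>2) = (\<lambda>x. (w $ 1)\<^sup>2 * ((x - c) $ 2)\<^sup>2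
        - 2 * w $ 1 * w $ 2 * ((x - c) $ 1 * (x - c) $ 2) + (w $ 2)\<^sup>2 * ((x - c) $ 1)\<^sup>2)"
      by (auto simp: wedge_def power2_eq_square algebra_simps)
    moreover have "(\<lambda>x. (w $ 1)\<^sup>2 * ((x - c) $ 2)\<^sup>2) integrable_on S"
       "(\<lambda>x. 2 * w $ 1 * w $ 2 * ((x - c) $ 1 * (x - c) $ 2)) integrable_on S"
       "(\<lambda>x. (w $ 2)\<^sup>2 * ((x - c) $ 1)\<^sup>2) integrable_on S"
      by (intro integrable_on_compact S continuous_intros)+
    ultimately show ?thesis
      unfolding q_def \<alpha>_def \<beta>_def \<delta>_def
      by (simp only: integral_add integral_diff integrable_diff integral_mult_right)
  qed
  have "(axis 1 1 :: real^2) \<noteq> 0" by simp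
  from q_pos[OF this] have \<alpha>: "\<alpha> > 0"
    unfolding q_eq by (simp add: axis_def)
  \<comment> \<open>Completing the square gives \<open>q w = \<alpha> * (w $ 1 - \<beta> / \<alpha>
    * w $ 2)\<^sup>2 + D * (w $ 2)\<^sup>2\<close>. The square roots of the two summands become the
    parts of \<open>L w\<close>.\<close>
  define D where "D = \<delta> - \<beta>\<^sup>2 / \<alpha>"
  have D: "D > 0"
  proof -
    \<comment> \<open>This vector makes the completed square vanish, so that \<open>q\<close> takes
      the value \<open>D\<close> there.\<close>
    let ?w = "(\<chi> i. if i = 1 then \<beta> / \<alpha> else 1) :: real^2"
    have "?w $ 2 \<noteq> 0" by simp
    then have "?w \<noteq> 0" by (metis zero_index)
    then have "q ?w > 0" by (rule q_pos)
    moreover have "q ?w = D"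
      using \<alpha> by (simp add: q_eq D_def power2_eq_square field_simps)
    ultimately show ?thesis by simp
  qed
  define L where "L w = Complex (sqrt \<alpha> * (w $ 1 - \<beta> / \<alpha> * w $ 2)) (sqrt D * w $ 2)" for w :: "real^2"
  have linL: "linear L"
    by (rule linearI) (simp_all add: L_def complex_eq_iff algebra_simps)
  have normL: "(norm (L w))\<^sup>2 = q w" for w
    using \<alpha> D by (simp add: L_def cmod_power2 power_mult_distrib q_eq)
      (simp add: D_def power2_eq_square field_simps)
  have "w = 0" if "L w = 0" for w
    using normL[of w] q_pos[of w] that by force
  then have "inj L" using linear_injective_0[OF linL] by blast
  moreover have "norm (L (A w)) = norm (L w)" if "linear A" "(\<lambda>x. A x + b) ` S = S" for A b w
    using q_inv[OF that] normL by (metis norm_ge_zero power2_eq_imp_eq)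
  ultimately show thesis using that linL fixc by blast
qed

subsection \<open>The classification\<close>

lemma interior_nonempty_if_affine_hull_UNIV:
  fixes S :: "'a::euclidean_space set"
  assumes "convex S" "affine hull S = UNIV"
  shows "interior S \<noteq> {}"
  using assms rel_interior_interior[of S] rel_interior_eq_empty[of S] by force

lemma affine_isomorphic_cball_complex:
  assumes r: "r > 0"
  shows "affine_isomorphic (cball (0 :: complex) r) (cball (0 :: real^2) 1)"
proof -
  define h :: "complex \<Rightarrow> real^2" where "h z = (\<chi> i. if i = 1 then Re z / r else Im z / r)" for z :: complex
  have h12: "h z $ 1 = Re z / r" "h z $ 2 = Im z / r" for z
    by (simp_all add: h_def)
  have lin: "linear h"
    by (rule linearI) (simp_all add: vec_eq_iff forall_2 h12 add_divide_distrib)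
  have norm_h: "norm (h z) = norm z / r" for z
  proof -
    have "norm (h z) = sqrt ((Re z / r)\<^sup>2 + (Im z / r)\<^sup>2)"
      by (simp add: norm_vec_def L2_set_def sum_2 h12)
    also have "\<dots> = sqrt (((Re z)\<^sup>2 + (Im z)\<^sup>2) / r\<^sup>2)"
      by (simp add: power_divide add_divide_distrib)
    also have "\<dots> = norm z / r"
      using r by (simp add: real_sqrt_divide cmod_def)
    finally show ?thesis .
  qed
  have norm_le: "norm (h z) \<le> 1 \<longleftrightarrow> norm z \<le> r" for z
    using r by (simp add: norm_h)
  define k where "k y = Complex (r * y $ 1) (r * y $ 2)" for y :: "real^2"
  have hk: "h (k y) = y" for y
    using r by (simp add: vec_eq_iff forall_2 h12 k_def)
  have kh: "k (h z) = z" for z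
    using r by (simp add: h12 k_def)
  have "bij_betw h (cball 0 r) (cball 0 1)"
  proof (rule bij_betw_byWitness[where f' = k])
    show "k ` cball 0 1 \<subseteq> cball 0 r"
      using norm_le[of "k _"] hk by auto
  qed (use hk kh norm_le in auto)
  moreover have "affine_map_on (cball 0 r) h"
    by (rule affine_map_on_linear_plus[OF lin, of _ _ 0]) auto
  ultimately show ?thesis unfolding affine_isomorphic_def by blast
qed

text \<open>The map \<open>N\<close> moves the common fixed point \<open>c\<close> to the origin and
  the invariant form to the Euclidean norm. Automorphisms of \<open>S\<close> then become linear
  isometries preserving the image, which must be a disk.\<close>

lemma affine_isomorphic_cball_if_transitive:
  fixes S :: "(real^2) set"
  assumes S: "compact S" "convex S" "interior S \<noteq> {}"
    and inf: "infinite (extreme_points S)"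
    and trans: "acts_transitively_on (affine_automorphisms S) (extreme_points S)"
  shows "affine_isomorphic S (cball (0 :: real^2) 1)"
proof -
  obtain c and L :: "real^2 \<Rightarrow> complex" where L: "linear L" "inj L"
    and fixc: "\<And>A b. linear A \<Longrightarrow> (\<lambda>x. A x + b) ` S = S \<Longrightarrow> A c + b = c"
    and inv: "\<And>A b w. linear A \<Longrightarrow> (\<lambda>x. A x + b) ` S = S \<Longrightarrow> norm (L (A w)) = norm (L w)"
    using affine_invariant_norm[OF S(1,3)] by metis
  obtain L' where L': "linear L'" "L' \<circ> L = id"
    using linear_injective_left_inverse[OF L] by blast
  have "dim (range L) = DIM(complex)"
    using dim_image_eq[OF L(1), of UNIV] L(2) by (simp add: inj_on_subset)
  then have "range L = UNIV"
    using dim_eq_full[of "range L"] span_eq_iff[THEN iffD2, OF linear_subspace_image[OF L(1) subspace_UNIV]]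
    by simp
  then have LL': "L (L' z) = z" for z
    using L'(2) by (metis comp_apply id_apply rangeE UNIV_I)
  define N where "N x = L (x - c)" for x
  let ?K = "N ` S"
  have N_affine: "N x = L x + (- L c)" for x by (simp add: N_def linear_diff[OF L(1)])
  have N: "affine_map_on S N"
    using affine_map_on_linear_plus[OF L(1) N_affine S(2)] .
  have inj: "inj_on N S" by (intro inj_onI) (auto simp: N_def dest!: injD[OF L(2)])
  note extK = extreme_points_affine_image[OF N inj S(2)]
  have "compact ?K"
    unfolding N_def using L(1) S(1)
    by (intro compact_continuous_image continuous_on_compose2[OF linear_continuous_on[of L UNIV]] continuous_intros)
       (auto simp: linear_conv_bounded_linear)
  moreover have "convex ?K" using convex_affine_image[OF N S(2)] .
  moreover have "infinite (extreme_points ?K)"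
    unfolding extK using inf inj
    by (metis (no_types, lifting) finite_imageD inj_on_subset extreme_points_def extreme_point_of_def mem_Collect_eq subsetI)
  moreover have "\<exists>B. linear B \<and> (\<forall>z. norm (B z) = norm z) \<and> B ` ?K = ?K \<and> B u = v"
    if uv: "u \<in> extreme_points ?K" "v \<in> extreme_points ?K" for u v
  proof -
    obtain x y where xy: "x \<in> extreme_points S" "y \<in> extreme_points S" "u = N x" "v = N y"
      using uv unfolding extK by blast
    have xS: "x \<in> S" using xy(1) by (simp add: extreme_points_def extreme_point_of_def)
    obtain g where g: "affine_map_on S g" "bij_betw g S S" "g x = y"
      using trans xy(1,2) unfolding acts_transitively_on_def affine_automorphisms_def by blast
    obtain A b where A: "linear A" "\<And>x. x \<in> S \<Longrightarrow> g x = A x + b"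
      using affine_map_on_extend[OF S(3) g(1)] by blast
    have gS: "g ` S = S" using g(2) by (simp add: bij_betw_def)
    have AS: "(\<lambda>x. A x + b) ` S = S" using gS A(2) by (metis (no_types, lifting) image_cong)
    \<comment> \<open>\<open>B\<close> is the linear part of \<open>g\<close> in the coordinates
      \<open>L\<close>. Because \<open>g\<close> fixes \<open>c\<close>, it agrees with
      \<open>g\<close> transported by \<open>N\<close>.\<close>
    define B where "B = L \<circ> (A \<circ> L')"
    have "linear B" unfolding B_def by (intro linear_compose L A L')
    moreover have "norm (B z) = norm z" for z
      using inv[OF A(1) AS, of "L' z"] by (simp add: B_def LL')
    moreover have BN: "B (N z) = N (g z)" if "z \<in> S" for z
    proof -
      have "B (N z) = L (A (z - c))"
        using L'(2) by (simp add: B_def N_def fun_eq_iff)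
      also have "A (z - c) = A z + b - (A c + b)" by (simp add: linear_diff[OF A(1)])
      also have "\<dots> = g z - c" using A(2)[OF that] fixc[OF A(1) AS] by simp
      finally show ?thesis by (simp add: N_def)
    qed
    moreover have "B ` ?K = ?K"
    proof -
      have "B ` N ` S = N ` g ` S" unfolding image_image using BN by (intro image_cong) auto
      then show ?thesis using gS by simp
    qed
    ultimately show ?thesis using BN[OF xS] g(3) xy(3,4) by blast
  qed
  ultimately obtain r where r: "r > 0" "?K = cball 0 r"
    by (rule complex_transitive_imp_cball)
  have "affine_isomorphic S (cball (0 :: complex) r)"
    using N inj r(2) unfolding affine_isomorphic_def bij_betw_def by blast
  then show ?thesis
    using affine_isomorphic_cball_complex[OF r(1)] S(2) by (rule affine_isomorphic_trans)
qed

theorem theorem3: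
  fixes S :: "(real ^ 2) set"
  assumes "compact S" and "convex S" and "affine hull S = UNIV"
  shows "((\<exists>T :: (real ^ 2) set. 2 simplex T \<and> affine_isomorphic S T) \<or>
          affine_isomorphic S (cball (0 :: real ^ 2) 1))
         \<longleftrightarrow>
         (acts_transitively_on (affine_automorphisms S) (extreme_points S) \<and> spectrality S)"
    (is "?lhs \<longleftrightarrow> ?rhs")
proof
  assume ?lhs
  \<comment> \<open>Both conditions are verified for the model \<open>T\<close>, a triangle or the
    disk, and then transferred to \<open>S\<close>.\<close>
  then obtain T :: "(real^2) set" where T: "affine_isomorphic S T" "interior T \<noteq> {}" "spectrality T"
    "acts_transitively_on (affine_automorphisms T) (extreme_points T)"
  proof (elim disjE exE conjE)
    fix T :: "(real^2) set" assume T: "2 simplex T" "affine_isomorphic S T"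
    then obtain C where C: "\<not> affine_dependent C" "int (card C) = 2 + 1" "T = convex hull C"
      unfolding simplex_def by blast
    have "affine hull C = UNIV" using C(1,2) by (intro affine_independent_span_eq) auto
    then have "interior T \<noteq> {}"
      unfolding C(3) by (intro interior_nonempty_if_affine_hull_UNIV) (auto simp: affine_hull_convex_hull)
    then show thesis
      using that T(2) transitive_simplex[OF C(1)] spectrality_simplex[OF C(1)] C(3) by blast
  next
    assume "affine_isomorphic S (cball (0 :: real^2) 1)"
    then show thesis
      by (rule that) (auto intro: spectrality_cball transitive_cball)
  qed
  then show ?rhs
    using transitive_affine_isomorphic spectrality_affine_isomorphic assms(2) by blast
next
  assume rhs: ?rhs
  note int = interior_nonempty_if_affine_hull_UNIV[OF assms(2,3)]
  show ?lhs
  proof (cases "2 simplex S")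
    case True
    moreover have "affine_isomorphic S S"
      unfolding affine_isomorphic_def affine_map_on_def by (intro exI[of _ id]) auto
    ultimately show ?thesis by blast
  next
    case False
    then have "infinite (extreme_points S)"
      using spectrality_infinite_extreme_points[OF _ int assms(2)] rhs by simp
    then show ?thesis
      using affine_isomorphic_cball_if_transitive[OF assms(1,2) int] rhs by blast
  qed
qed

end
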